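(* Let $f$ be a formula over three variables such that $ABA.BCB.ACA\preceq f\preceq ABA.ABCBA.ACA.ACB.BCA$. Every ternary recurrent infinite word avoiding $f$ is equivalent to $w_3$, $\sigma(w_3)$, or $\sigma^2(w_3)$.
   Context: A formula is a finite set of non-empty words over variables $A,B,C,\dots$ (fragments), written separated by dots. An occurrence of a formula $f$ in a word $w$ is a non-erasing morphism $h$ from variables to non-empty words such that $h(\phi)$ is a factor of $w$ for every fragment $\phi$ of $f$; $w$ avoids $f$ if it has no occurrence. $g\preceq f$ means there is a non-erasing morphism $h$ such that the $h$-image of every fragment of $g$ is a factor of some fragment of $f$. An infinite word is recurrent if each of its finite factors occurs infinitely often; two infinite words are equivalent if they have the same set of finite factors. Let $\Sigma_3=\{0,1,2\}$ and $\sigma$ be the morphism $0\mapsto1,1\mapsto2,2\mapsto0$. Let $b_5$ be the fixed point starting with $0$ of the morphism $0\mapsto 01,\ 1\mapsto 23,\ 2\mapsto 4,\ 3\mapsto 21,\ 4\mapsto 0$, and let $w_3=M_2(b_5)$ where $M_2$ is the morphism $0\mapsto 02,\ 1\mapsto 1,\ 2\mapsto 0,\ 3\mapsto 12,\ 4\mapsto\varepsilon$. *)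

theory Defs
  imports "HOL-Library.Sublist"
begin

text \<open>Finite words are lists, (right-)infinite words are functions on \<^typ>\<open>nat\<close>.\<close>

definition morph :: "('a \<Rightarrow> 'b list) \<Rightarrow> 'a list \<Rightarrow> 'b list" where
  "morph h u = concat (map h u)"

definition nonerasing :: "('a \<Rightarrow> 'b list) \<Rightarrow> bool" where
  "nonerasing h \<longleftrightarrow> (\<forall>x. h x \<noteq> [])"

text \<open>The \<open>n\<close>-th letter of the image of \<open>w\<close> is read off the image of any prefix of \<open>w\<close> whose
  image is long enough.  Some morphisms below erase letters, so the length of that prefix is not
  bounded by \<open>n + 1\<close>; if the image is finite, the value is meaningless beyond its end.\<close>

definition morph_inf :: "('a \<Rightarrow> 'b list) \<Rightarrow> (nat \<Rightarrow> 'a) \<Rightarrow> nat \<Rightarrow> 'b" where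
  "morph_inf h w n =
    (let m = LEAST m. n < length (morph h (map w [0..<m])) in morph h (map w [0..<m]) ! n)"

definition occurs_at :: "'a list \<Rightarrow> (nat \<Rightarrow> 'a) \<Rightarrow> nat \<Rightarrow> bool" where
  "occurs_at u w i \<longleftrightarrow> map w [i..<i + length u] = u"

definition factors :: "(nat \<Rightarrow> 'a) \<Rightarrow> 'a list set" where
  "factors w = {u. \<exists>i. occurs_at u w i}"

definition recurrent :: "(nat \<Rightarrow> 'a) \<Rightarrow> bool" where
  "recurrent w \<longleftrightarrow> (\<forall>u\<in>factors w. infinite {i. occurs_at u w i})"

definition equivalent :: "(nat \<Rightarrow> 'a) \<Rightarrow> (nat \<Rightarrow> 'a) \<Rightarrow> bool" where
  "equivalent w w' \<longleftrightarrow> factors w = factors w'"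

definition is_formula :: "'v list set \<Rightarrow> bool" where
  "is_formula f \<longleftrightarrow> finite f \<and> [] \<notin> f"

definition vars :: "'v list set \<Rightarrow> 'v set" where
  "vars f = (\<Union>\<phi>\<in>f. set \<phi>)"

definition occurrence :: "('v \<Rightarrow> 'a list) \<Rightarrow> 'v list set \<Rightarrow> (nat \<Rightarrow> 'a) \<Rightarrow> bool" where
  "occurrence h f w \<longleftrightarrow> nonerasing h \<and> (\<forall>\<phi>\<in>f. morph h \<phi> \<in> factors w)"

definition avoids :: "(nat \<Rightarrow> 'a) \<Rightarrow> 'v list set \<Rightarrow> bool" where
  "avoids w f \<longleftrightarrow> \<not> (\<exists>h. occurrence h f w)"

definition formula_le :: "'v list set \<Rightarrow> 'u list set \<Rightarrow> bool" (infix "\<preceq>" 50) where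
  "g \<preceq> f \<longleftrightarrow> (\<exists>h. nonerasing h \<and> (\<forall>\<phi>\<in>g. \<exists>\<psi>\<in>f. sublist (morph h \<phi>) \<psi>))"

datatype var = A | B | C

text \<open>The morphisms are only ever applied to words over \<open>{0..4}\<close> or \<open>{0..2}\<close>; the value on other
  numbers is irrelevant.\<close>

definition sigma :: "nat \<Rightarrow> nat list" where
  "sigma x = (if x = 0 then [1] else if x = 1 then [2] else if x = 2 then [0] else [])"

definition b5_morphism :: "nat \<Rightarrow> nat list" where
  "b5_morphism x =
    (if x = 0 then [0, 1] else if x = 1 then [2, 3] else if x = 2 then [4]
     else if x = 3 then [2, 1] else if x = 4 then [0] else [])"

definition M2 :: "nat \<Rightarrow> nat list" where
  "M2 x =
    (if x = 0 then [0, 2] else if x = 1 then [1] else if x = 2 then [0]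
     else if x = 3 then [1, 2] else [])"

definition b5 :: "nat \<Rightarrow> nat" where
  "b5 = (THE w. w 0 = 0 \<and> morph_inf b5_morphism w = w)"

definition w3 :: "nat \<Rightarrow> nat" where
  "w3 = morph_inf M2 b5"

text \<open>The description of \<^const>\<open>b5\<close> is proper, and its prefixes are the iterates on \<open>0\<close>.\<close>

lemma morph_append: "morph h (u @ v) = morph h u @ morph h v"
  by (simp add: morph_def)

lemma morph_prefix_mono: "m \<le> m' \<Longrightarrow> prefix (morph h (map w [0..<m])) (morph h (map w [0..<m']))"
  by (metis le_add_diff_inverse map_append morph_append prefixI upt_add_eq_append zero_le)

lemma morph_inf_nth:
  assumes "n < length (morph h (map w [0..<m]))"
  shows "morph_inf h w n = morph h (map w [0..<m]) ! n"
proof -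
  define k where "k = (LEAST k. n < length (morph h (map w [0..<k])))"
  have "n < length (morph h (map w [0..<k]))"
    unfolding k_def using assms by (rule LeastI)
  moreover have "k \<le> m"
    unfolding k_def using assms by (rule Least_le)
  ultimately have "morph h (map w [0..<m]) ! n = morph h (map w [0..<k]) ! n"
    using morph_prefix_mono[of k m h w] by (auto simp: prefix_def nth_append)
  then show ?thesis
    by (simp add: morph_inf_def k_def Let_def)
qed

definition b5_iter :: "nat \<Rightarrow> nat list" where
  "b5_iter k = (morph b5_morphism ^^ k) [0]"

lemma b5_iter_Suc: "b5_iter (Suc k) = morph b5_morphism (b5_iter k)"
  by (simp add: b5_iter_def)

lemma morph_b5_letters: "set u \<subseteq> {0..4} \<Longrightarrow> set (morph b5_morphism u) \<subseteq> {0..4}"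
  by (auto simp: morph_def b5_morphism_def split: if_splits)

lemma morph_b5_length: "set u \<subseteq> {0..4} \<Longrightarrow> length u \<le> length (morph b5_morphism u)"
proof (induction u)
  case (Cons x u)
  then have "1 \<le> length (b5_morphism x)"
    by (auto simp: b5_morphism_def)
  with Cons show ?case by (auto simp: morph_def)
qed (simp add: morph_def)

lemma b5_iter_shape: "set (b5_iter k) \<subseteq> {0..4} \<and> (\<exists>r. b5_iter k = 0 # r) \<and> k < length (b5_iter k)"
proof (induction k)
  case 0
  show ?case by (simp add: b5_iter_def)
next
  case (Suc k)
  then obtain r where r: "b5_iter k = 0 # r" by blast
  have S: "b5_iter (Suc k) = 0 # 1 # morph b5_morphism r"
    by (simp add: b5_iter_Suc r morph_def b5_morphism_def)
  have "set r \<subseteq> {0..4}" using Suc r by auto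
  then have "length r \<le> length (morph b5_morphism r)" by (rule morph_b5_length)
  moreover have "set (b5_iter (Suc k)) \<subseteq> {0..4}"
    unfolding b5_iter_Suc using Suc by (intro morph_b5_letters) blast
  ultimately show ?case using S Suc r by auto
qed

lemma b5_iter_prefix_Suc: "prefix (b5_iter k) (b5_iter (Suc k))"
proof (induction k)
  case 0
  show ?case by (simp add: b5_iter_def morph_def b5_morphism_def)
next
  case (Suc k)
  then obtain r where "b5_iter (Suc k) = b5_iter k @ r" by (auto simp: prefix_def)
  then have "b5_iter (Suc (Suc k)) = b5_iter (Suc k) @ morph b5_morphism r"
    by (metis b5_iter_Suc morph_append)
  then show ?case by simp
qed

lemma b5_iter_prefix: "k \<le> l \<Longrightarrow> prefix (b5_iter k) (b5_iter l)"
  by (induction l rule: dec_induct) (auto intro: prefix_order.trans b5_iter_prefix_Suc)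

lemma b5_iter_nth:
  assumes "n < length (b5_iter k)"
  shows "b5_iter k ! n = b5_iter n ! n"
proof -
  have "n < length (b5_iter n)" using b5_iter_shape by blast
  then show ?thesis
    using assms b5_iter_prefix[of k n] b5_iter_prefix[of n k]
    by (cases "k \<le> n") (auto simp: prefix_def nth_append)
qed

lemma b5_fixed_point_prefix:
  assumes "w 0 = 0" and "morph_inf b5_morphism w = w"
  shows "map w [0..<length (b5_iter k)] = b5_iter k"
proof (induction k)
  case 0
  show ?case using assms(1) by (simp add: b5_iter_def)
next
  case (Suc k)
  have "w n = b5_iter (Suc k) ! n" if "n < length (b5_iter (Suc k))" for n
    using morph_inf_nth[of n b5_morphism w "length (b5_iter k)"] that assms(2)
    by (simp add: Suc b5_iter_Suc)
  then show ?case by (intro nth_equalityI) auto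
qed

lemma b5_iter_fixed_point:
  defines "b \<equiv> \<lambda>n. b5_iter n ! n"
  shows "b 0 = 0" and "morph_inf b5_morphism b = b"
proof -
  show "b 0 = 0" by (simp add: b_def b5_iter_def)
  show "morph_inf b5_morphism b = b"
  proof
    fix n
    have *: "map b [0..<length (b5_iter n)] = b5_iter n"
      by (rule nth_equalityI) (auto simp: b_def dest: b5_iter_nth)
    have n: "n < length (b5_iter (Suc n))"
      using b5_iter_shape[of "Suc n"] by auto
    then have "morph_inf b5_morphism b n = b5_iter (Suc n) ! n"
      using morph_inf_nth[of n b5_morphism b "length (b5_iter n)"]
      unfolding * b5_iter_Suc by blast
    also have "\<dots> = b n"
      unfolding b_def using n by (rule b5_iter_nth)
    finally show "morph_inf b5_morphism b n = b n" .
  qed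
qed

lemma b5_ex1: "\<exists>!w. w 0 = 0 \<and> morph_inf b5_morphism w = w"
proof (rule ex1I)
  show "b5_iter 0 ! 0 = 0 \<and> morph_inf b5_morphism (\<lambda>n. b5_iter n ! n) = (\<lambda>n. b5_iter n ! n)"
    using b5_iter_fixed_point by simp
next
  fix w :: "nat \<Rightarrow> nat"
  assume w: "w 0 = 0 \<and> morph_inf b5_morphism w = w"
  show "w = (\<lambda>n. b5_iter n ! n)"
  proof
    fix n
    have "n < length (b5_iter n)" using b5_iter_shape by blast
    then show "w n = b5_iter n ! n"
      using arg_cong[OF b5_fixed_point_prefix[of w n], of "\<lambda>u. u ! n"] w by simp
  qed
qed

lemma b5_fixed_point: "b5 0 = 0" "morph_inf b5_morphism b5 = b5"
  using theI'[OF b5_ex1] by (simp_all add: b5_def)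

lemma b5_prefix: "map b5 [0..<length (b5_iter k)] = b5_iter k"
  by (rule b5_fixed_point_prefix[OF b5_fixed_point])

end

theory Submission
  imports Defs
begin

text \<open>
  Avoiding \<open>f\<close>, the word \<open>w\<close> also avoids \<open>ABA.ABCBA.ACA.ACB.BCA\<close>. Recurrence turns any square of \<open>w\<close> into an occurrence of this formula, so \<open>w\<close> is square-free. An infinite ternary
  square-free word contains all six words \<open>abc\<close> on distinct letters, so an occurrence with single
  letters exists as soon as \<open>aba\<close>, \<open>bcb\<close> and \<open>aca\<close> are factors; this forces \<open>aba\<close> and \<open>bab\<close> to be
  both absent for some pair of letters. Up to \<open>\<sigma>\<close> the pair is \<open>{1, 2}\<close>, and it remains to prove
  Thue's characterization of the recurrent square-free words without \<open>121\<close> and \<open>212\<close>.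

  Such a word is a product of the blocks \<open>021012\<close>, \<open>01\<close>, \<open>02\<close>, \<open>012\<close>, \<open>021\<close>, the images of the five letters
  under \<open>M\<^sub>2 \<circ> \<beta>\<^sup>2\<close> with \<open>\<beta>\<close> the morphism of \<open>b\<^sub>5\<close>. Away from the ends, square-freeness leaves only the
  factors of length 3 of \<open>b\<^sub>5\<close> in the coding word; these allow one to desubstitute by \<open>\<beta>\<close>, and the
  preimage has the same property. Hence every factor of \<open>w\<close> lies in \<open>M\<^sub>2(\<beta>\<^sup>n(xyz))\<close> with \<open>xyz\<close> a factor
  of \<open>b\<^sub>5\<close>, and \<open>w\<close> contains \<open>M\<^sub>2(\<beta>\<^sup>n(0))\<close> for every \<open>n\<close>.
\<close>

subsection \<open>Factors of recurrent words\<close>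

lemma morph_simps [simp]: "morph h [] = []" "morph h (x # u) = h x @ morph h u"
  by (simp_all add: morph_def)

lemma morph_morph: "morph g (morph h u) = morph (\<lambda>x. morph g (h x)) u"
  by (induction u) (simp_all add: morph_append)

lemma sublist_morph: "sublist u v \<Longrightarrow> sublist (morph h u) (morph h v)"
  by (metis morph_append sublist_def)

lemma sublist_factors:
  assumes "u \<in> factors w" "sublist v u"
  shows "v \<in> factors w"
proof -
  from assms obtain i p q where i: "map w [i..<i + length u] = u" and u: "u = p @ v @ q"
    by (auto simp: factors_def occurs_at_def sublist_def)
  have "map w [i + length p..<i + length p + length v] = v"
  proof (rule nth_equalityI)
    fix j assume "j < length (map w [i + length p..<i + length p + length v])"
    then have j: "j < length v" by simp
    have "u ! (length p + j) = v ! j"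
      using j by (simp add: u nth_append)
    moreover have "u ! (length p + j) = w (i + (length p + j))"
      using j by (subst i[symmetric]) (simp add: u)
    ultimately show "map w [i + length p..<i + length p + length v] ! j = v ! j"
      using j by (simp add: add.assoc)
  qed simp
  then show ?thesis
    by (auto simp: factors_def occurs_at_def)
qed

lemma map_upt_in_factors: "map w [i..<j] \<in> factors w"
  by (cases "i \<le> j") (auto simp: factors_def occurs_at_def intro: exI[of _ i])

lemma recurrent_occurs_beyond:
  assumes "recurrent w" "u \<in> factors w"
  shows "\<exists>i\<ge>k. occurs_at u w i"
proof (rule ccontr)
  assume "\<not> ?thesis"
  then have "{i. occurs_at u w i} \<subseteq> {..<k}" by (auto simp: not_le)
  then have "finite {i. occurs_at u w i}" by (rule finite_subset) simp
  with assms show False by (auto simp: recurrent_def)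
qed

lemma upt_split: "i \<le> j \<Longrightarrow> j \<le> k \<Longrightarrow> [i..<k] = [i..<j] @ [j..<k]"
  using upt_add_eq_append[of i j "k - j"] by simp

text \<open>Recurrence gives an occurrence that starts beyond the end of a first one, so the two do
  not overlap.\<close>

lemma recurrent_repeat:
  assumes "recurrent w" "u \<in> factors w"
  shows "\<exists>t. u @ t @ u \<in> factors w"
proof -
  obtain i where i: "map w [i..<i + length u] = u"
    using assms(2) by (auto simp: factors_def occurs_at_def)
  obtain j where j: "j \<ge> i + length u" "map w [j..<j + length u] = u"
    using recurrent_occurs_beyond[OF assms] by (auto simp: occurs_at_def)
  have "[i..<j + length u] = [i..<i + length u] @ [i + length u..<j] @ [j..<j + length u]"
    using j(1) upt_split[of i "i + length u" "j + length u"] upt_split[of "i + length u" j "j + length u"]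
    by simp
  then show ?thesis
    using map_upt_in_factors[of w i "j + length u"] i j(2) by auto
qed

text \<open>An infinite word has a left end; an occurrence that starts at a position at least
  \<open>k\<close> leaves room for \<open>s\<close>.\<close>

lemma recurrent_extend:
  assumes "recurrent w" "u \<in> factors w"
  shows "\<exists>s t. length s = k \<and> length t = k \<and> s @ u @ t \<in> factors w"
proof -
  obtain j where j: "j \<ge> k" "map w [j..<j + length u] = u"
    using recurrent_occurs_beyond[OF assms] by (auto simp: occurs_at_def)
  have "[j - k..<j + length u + k] = [j - k..<j] @ [j..<j + length u] @ [j + length u..<j + length u + k]"
    using j(1) upt_split[of "j - k" j "j + length u + k"] upt_split[of j "j + length u" "j + length u + k"]
    by simp
  then have "map w [j - k..<j] @ u @ map w [j + length u..<j + length u + k] \<in> factors w"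
    using map_upt_in_factors[of w "j - k" "j + length u + k"] j(2) by simp
  then show ?thesis
    using j(1) by (intro exI[of _ "map w [j - k..<j]"] exI[of _ "map w [j + length u..<j + length u + k]"]) simp
qed

text \<open>An occurrence of \<open>g\<close> composed with the morphism that witnesses
  \<open>f \<preceq> g\<close> is an occurrence of \<open>f\<close>.\<close>

lemma avoids_mono:
  assumes "f \<preceq> g" "avoids w f"
  shows "avoids w g"
  unfolding avoids_def
proof
  assume "\<exists>h. occurrence h g w"
  then obtain h where h: "occurrence h g w" ..
  obtain k where k: "nonerasing k" "\<forall>\<phi>\<in>f. \<exists>\<psi>\<in>g. sublist (morph k \<phi>) \<psi>"
    using assms(1) by (auto simp: formula_le_def)
  have "nonerasing (\<lambda>x. morph h (k x))"
    using h k(1) by (auto simp: occurrence_def nonerasing_def) (metis morph_simps(2) append_is_Nil_conv neq_Nil_conv)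
  moreover have "morph (\<lambda>x. morph h (k x)) \<phi> \<in> factors w" if "\<phi> \<in> f" for \<phi>
    using that k(2) h sublist_morph[of "morph k \<phi>" _ h] sublist_factors
    by (fastforce simp: occurrence_def morph_morph)
  ultimately show False
    using assms(2) by (auto simp: avoids_def occurrence_def)
qed

abbreviation (input) upper_formula where
  "upper_formula \<equiv> {[A, B, A], [A, B, C, B, A], [A, C, A], [A, C, B], [B, C, A]}"

lemma avoids_upper_formula:
  assumes "avoids w upper_formula" "X \<noteq> []" "Y \<noteq> []" "Z \<noteq> []"
    and "X @ Y @ X \<in> factors w" "X @ Y @ Z @ Y @ X \<in> factors w" "X @ Z @ X \<in> factors w"
    and "X @ Z @ Y \<in> factors w" "Y @ Z @ X \<in> factors w"
  shows False
proof -
  have "occurrence (\<lambda>x. case x of A \<Rightarrow> X | B \<Rightarrow> Y | C \<Rightarrow> Z) upper_formula w"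
    using assms(2-) by (auto simp: occurrence_def nonerasing_def split: var.split)
  with assms(1) show False by (auto simp: avoids_def)
qed

definition square_free :: "'a list \<Rightarrow> bool" where
  "square_free u \<longleftrightarrow> (\<forall>x. x \<noteq> [] \<longrightarrow> \<not> sublist (x @ x) u)"

text \<open>If \<open>u\<^sup>2\<close> is a factor, recurrence yields factors \<open>y = u\<^sup>2 t u\<^sup>2\<close> and \<open>y s y\<close>, and then
  \<open>A \<mapsto> u\<close>, \<open>B \<mapsto> u t u\<close>, \<open>C \<mapsto> u s u\<close> is an occurrence.\<close>

lemma avoids_upper_formula_square_free:
  assumes "recurrent w" "avoids w upper_formula" "v \<in> factors w"
  shows "square_free v"
  unfolding square_free_def
proof (intro allI impI notI)
  fix u assume u: "u \<noteq> []" "sublist (u @ u) v"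
  then have "u @ u \<in> factors w" using assms(3) sublist_factors by blast
  then obtain t where "(u @ u) @ t @ (u @ u) \<in> factors w"
    using recurrent_repeat[OF assms(1)] by blast
  then obtain s where s: "((u @ u) @ t @ (u @ u)) @ s @ ((u @ u) @ t @ (u @ u)) \<in> factors w" (is "?y \<in> _")
    using recurrent_repeat[OF assms(1)] by blast
  have sub: "x \<in> factors w" if "?y = p @ x @ q" for p x q
    using s sublist_factors[OF s, of x] that by (metis sublist_def)
  show False
  proof (rule avoids_upper_formula[OF assms(2), of u "u @ t @ u" "u @ s @ u"])
    show "u @ (u @ t @ u) @ u \<in> factors w"
      by (rule sub[of "[]" _ "s @ u @ u @ t @ u @ u"]) simp
    show "u @ (u @ t @ u) @ (u @ s @ u) @ (u @ t @ u) @ u \<in> factors w"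
      by (rule sub[of "[]" _ "[]"]) simp
    show "u @ (u @ s @ u) @ u \<in> factors w"
      by (rule sub[of "u @ u @ t" _ "t @ u @ u"]) simp
    show "u @ (u @ s @ u) @ u @ t @ u \<in> factors w"
      by (rule sub[of "u @ u @ t" _ "u"]) simp
    show "(u @ t @ u) @ (u @ s @ u) @ u \<in> factors w"
      by (rule sub[of "u" _ "t @ u @ u"]) simp
  qed (use u in auto)
qed

subsection \<open>Enumeration of words by left extension\<close>

fun agree :: "nat \<Rightarrow> 'a list \<Rightarrow> 'a list \<Rightarrow> bool" where
  "agree 0 u v = True"
| "agree (Suc n) (x # u) (y # v) = (if x = y then agree n u v else False)"
| "agree (Suc n) u v = False"

lemma agree_prefix: "agree n u v \<Longrightarrow> take n u = take n v \<and> n \<le> length u \<and> n \<le> length v"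
  by (induction n u v rule: agree.induct) (auto split: if_splits)

text \<open>The search starts as \<open>square_prefix Q u 0 u\<close>. The counter \<open>l\<close>
  and the last argument \<open>drop l u\<close> move together, so each step compares the first
  \<open>Suc l\<close> letters of \<open>u\<close> with the \<open>Suc l\<close> letters behind
  them. The predicate \<open>Q\<close> restricts the root of the square.\<close>

fun square_prefix :: "('a list \<Rightarrow> bool) \<Rightarrow> 'a list \<Rightarrow> nat \<Rightarrow> 'a list \<Rightarrow> bool" where
  "square_prefix Q u l [] = False"
| "square_prefix Q u l (x # v) =
    (if agree (Suc l) u v then if Q (take (Suc l) u) then True else square_prefix Q u (Suc l) v
     else square_prefix Q u (Suc l) v)"

lemma square_prefix_sound:
  assumes "square_prefix Q u l v" "v = drop l u"
  shows "\<exists>x. x \<noteq> [] \<and> Q x \<and> prefix (x @ x) u"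
  using assms
proof (induction Q u l v rule: square_prefix.induct)
  case (2 Q u l x v)
  have v: "v = drop (Suc l) u"
    using 2(4) by (metis drop_Suc drop_tl list.sel(3))
  show ?case
  proof (cases "agree (Suc l) u v \<and> Q (take (Suc l) u)")
    case True
    then have *: "take (Suc l) u = take (Suc l) v" "Suc l \<le> length u" "Suc l \<le> length v"
      using agree_prefix by blast+
    have "u = take (Suc l) u @ take (Suc l) v @ drop (Suc l) v"
      using v by (metis append_take_drop_id)
    then have "prefix (take (Suc l) u @ take (Suc l) u) u"
      using *(1) by (metis append.assoc prefixI)
    moreover have "take (Suc l) u \<noteq> []" using *(2) by auto
    ultimately show ?thesis using True by blast
  next
    case False
    then show ?thesis
      using 2(1-3) v by (auto split: if_splits)
  qed
qed simp

fun has_square :: "('a list \<Rightarrow> bool) \<Rightarrow> 'a list \<Rightarrow> bool" where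
  "has_square Q [] = False"
| "has_square Q (x # u) = (if square_prefix Q (x # u) 0 (x # u) then True else has_square Q u)"

lemma has_square_sound:
  "has_square Q u \<Longrightarrow> \<exists>x. x \<noteq> [] \<and> Q x \<and> sublist (x @ x) u"
proof (induction u)
  case (Cons a u)
  show ?case
  proof (cases "square_prefix Q (a # u) 0 (a # u)")
    case True
    then show ?thesis using square_prefix_sound[OF True] prefix_imp_sublist by auto
  next
    case False
    then show ?thesis using Cons sublist_Cons_right by fastforce
  qed
qed simp

text \<open>Since letters are prepended, every non-empty suffix of a surviving word has passed
  \<open>P\<close>. Each factor of a word is a prefix of a suffix, so it is enough that
  \<open>P\<close> inspects prefixes.\<close>

primrec grow :: "('a list \<Rightarrow> bool) \<Rightarrow> 'a list \<Rightarrow> nat \<Rightarrow> 'a list list" where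
  "grow P as 0 = [[]]"
| "grow P as (Suc n) = filter P (concat (map (\<lambda>u. map (\<lambda>x. x # u) as) (grow P as n)))"

lemma in_grow:
  assumes "length v = n" "set v \<subseteq> set as" "\<And>s. suffix s v \<Longrightarrow> s \<noteq> [] \<Longrightarrow> P s"
  shows "v \<in> set (grow P as n)"
  using assms
proof (induction v arbitrary: n)
  case (Cons x v)
  then have "v \<in> set (grow P as (length v))"
    by (simp add: suffix_Cons)
  moreover have "P (x # v)" using Cons.prems by simp
  ultimately show ?case using Cons.prems by (auto intro!: bexI[of _ v])
qed simp

subsection \<open>Ternary square-free words\<close>

definition ternary_square_free :: "(nat \<Rightarrow> nat) \<Rightarrow> bool" where
  "ternary_square_free w \<longleftrightarrow>
    range w \<subseteq> {0, 1, 2} \<and> recurrent w \<and> (\<forall>u\<in>factors w. square_free u)"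

lemma set_factor: "u \<in> factors w \<Longrightarrow> set u \<subseteq> range w"
proof -
  assume "u \<in> factors w"
  then obtain i where "map w [i..<i + length u] = u"
    by (auto simp: factors_def occurs_at_def)
  then have "set u = w ` {i..<i + length u}"
    by (metis list.set_map set_upt)
  then show ?thesis by auto
qed

lemma square_free_sublist: "square_free u \<Longrightarrow> sublist v u \<Longrightarrow> square_free v"
  unfolding square_free_def using sublist_order.order.trans by blast

lemma not_square_free: "x \<noteq> [] \<Longrightarrow> \<not> square_free (p @ x @ x @ q)"
  using sublist_appendI[of "x @ x" p q] by (auto simp: square_free_def)

definition avoiding_words :: "nat list \<Rightarrow> nat \<Rightarrow> nat list list" where
  "avoiding_words u = grow (\<lambda>s. if take (length u) s = u then False
    else \<not> square_prefix (\<lambda>_. True) s 0 s) [0, 1, 2]"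

lemma in_avoiding_words:
  assumes "square_free v" "set v \<subseteq> {0, 1, 2}" "\<not> sublist u v"
  shows "v \<in> set (avoiding_words u (length v))"
  unfolding avoiding_words_def
proof (rule in_grow)
  fix s assume s: "suffix s v" "s \<noteq> []"
  then have sub: "sublist s v" by (simp add: suffix_imp_sublist)
  have "take (length u) s \<noteq> u"
    using assms(3) sublist_order.order.trans[OF sublist_take[of "length u" s] sub] by metis
  moreover have "\<not> square_prefix (\<lambda>_. True) s 0 s"
  proof
    assume "square_prefix (\<lambda>_. True) s 0 s"
    from square_prefix_sound[OF this] obtain x where "x \<noteq> []" "prefix (x @ x) s" by auto
    then show False
      using square_free_sublist[OF assms(1) sub] prefix_imp_sublist unfolding square_free_def by blast
  qed
  ultimately show "if take (length u) s = u then False else \<not> square_prefix (\<lambda>_. True) s 0 s"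
    by simp
qed (use assms in auto)

text \<open>A finite search; \<open>permutation_factor\<close> transfers its outcome to every
  ordering of the three letters.\<close>

lemma avoiding_012: "avoiding_words [0, 1, 2] 30 = []"
  by code_simp

lemma sublist_mapE:
  assumes "sublist u (map f v)"
  obtains t where "sublist t v" "map f t = u"
proof -
  from assms obtain p q where "map f v = p @ u @ q" by (auto simp: sublist_def)
  then obtain p' t q' where "v = p' @ t @ q'" "map f t = u"
    unfolding map_eq_append_conv append_eq_map_conv by blast
  then show ?thesis using that by auto
qed

lemma square_free_map:
  assumes "square_free v" "inj_on f (set v)"
  shows "square_free (map f v)"
  unfolding square_free_def
proof (intro allI impI notI)
  fix x assume x: "x \<noteq> []" "sublist (x @ x) (map f v)"
  from x(2) obtain t where t: "sublist t v" "map f t = x @ x" by (rule sublist_mapE)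
  then obtain y z where yz: "t = y @ z" "map f y = x" "map f z = x"
    by (auto simp: map_eq_append_conv)
  have "set y \<union> set z \<subseteq> set v"
    using t(1) yz(1) by (auto simp: sublist_def)
  then have "y = z"
    using yz assms(2) by (metis inj_on_subset map_inj_on)
  then show False
    using x(1) t(1) yz assms(1) by (auto simp: square_free_def)
qed

lemma ternary_letters:
  "distinct [a, b, c] \<Longrightarrow> {a, b, c} \<subseteq> {0, 1, 2 :: nat} \<Longrightarrow> {0, 1, 2} = {a, b, c}"
  by (intro card_subset_eq[symmetric]) auto

text \<open>Relabelling \<open>a\<close>, \<open>b\<close>, \<open>c\<close> as \<open>0\<close>,
  \<open>1\<close>, \<open>2\<close> preserves square-freeness, and a relabelled prefix of length 30
  must contain \<open>012\<close>.\<close>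

lemma permutation_factor:
  assumes "ternary_square_free w" "distinct [a, b, c]" "{a, b, c} \<subseteq> {0, 1, 2}"
  shows "[a, b, c] \<in> factors w"
proof -
  let ?v = "map w [0..<30]"
  have v: "?v \<in> factors w" by (rule map_upt_in_factors)
  have abc: "set ?v \<subseteq> {a, b, c}"
    using set_factor[OF v] assms(1) ternary_letters[OF assms(2,3)]
    unfolding ternary_square_free_def by blast
  define f :: "nat \<Rightarrow> nat" where "f x = (if x = a then 0 else if x = b then 1 else 2)" for x
  have inj: "inj_on f (set ?v)"
    using assms(2) by (intro inj_on_subset[OF _ abc]) (auto simp: inj_on_def f_def)
  have "square_free (map f ?v)"
    using assms(1) v by (intro square_free_map[OF _ inj]) (auto simp: ternary_square_free_def)
  moreover have "set (map f ?v) \<subseteq> {0, 1, 2}"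
    by (auto simp: f_def)
  moreover have "map f ?v \<notin> set (avoiding_words [0, 1, 2] (length (map f ?v)))"
    using avoiding_012 by (simp del: map_map)
  ultimately have "sublist [0, 1, 2] (map f ?v)"
    using in_avoiding_words by blast
  then obtain t where t: "sublist t ?v" "map f t = [0, 1, 2]"
    by (rule sublist_mapE)
  have "set t \<subseteq> {a, b, c}"
    using t(1) abc set_mono_sublist by blast
  then have "t = [a, b, c]"
    using t(2) by (auto simp: f_def map_eq_Cons_conv split: if_splits)
  then show ?thesis
    using t(1) v sublist_factors by blast
qed

lemma square_factor:
  assumes "ternary_square_free w" "p @ x @ x @ q \<in> factors w"
  shows "x = []"
  using assms not_square_free[of x p q] unfolding ternary_square_free_def by blast

text \<open>Square-freeness forces the letter on either side of \<open>bcb\<close> to be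
  \<open>a\<close>, which gives \<open>abcba\<close>. Together with \<open>acb\<close> and
  \<open>bca\<close>, which always occur, the single letters then form an occurrence of the upper
  formula.\<close>

lemma no_transitive_triple:
  assumes w: "ternary_square_free w" "avoids w upper_formula"
    and abc: "distinct [a, b, c]" "{a, b, c} \<subseteq> {0, 1, 2}"
    and "[a, b, a] \<in> factors w" "[b, c, b] \<in> factors w" "[a, c, a] \<in> factors w"
  shows False
proof -
  obtain s t where st: "length s = 1" "length t = 1" "s @ [b, c, b] @ t \<in> factors w"
    using recurrent_extend[of w "[b, c, b]" 1] assms(6) w(1) by (auto simp: ternary_square_free_def)
  then obtain x y where xy: "[x, b, c, b, y] \<in> factors w"
    by (cases s; cases t) auto
  have "{x, y} \<subseteq> {a, b, c}"
    using set_factor[OF xy] w(1) ternary_letters[OF abc] unfolding ternary_square_free_def by auto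
  moreover have "x \<noteq> b" "x \<noteq> c" "y \<noteq> b" "y \<noteq> c"
    using xy square_factor[OF w(1), of "[]" "[b]" "[c, b, y]"] square_factor[OF w(1), of "[]" "[c, b]" "[y]"]
      square_factor[OF w(1), of "[x, b, c]" "[b]" "[]"] square_factor[OF w(1), of "[x]" "[b, c]" "[]"]
    by auto
  ultimately have "[a, b, c, b, a] \<in> factors w"
    using xy by auto
  moreover have "[a, c, b] \<in> factors w" "[b, c, a] \<in> factors w"
    using permutation_factor[OF w(1)] abc by auto
  ultimately show False
    using avoids_upper_formula[OF w(2), of "[a]" "[b]" "[c]"] assms(5-) by simp
qed

text \<open>Extending \<open>bca\<close> to the left, each new letter is forced by square-freeness
  and one of the missing words: first \<open>a\<close>, then \<open>c\<close>, then
  \<open>b\<close>. The result is the square \<open>bcabca\<close>.\<close>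

lemma no_cyclic_triple:
  assumes w: "ternary_square_free w"
    and abc: "distinct [a, b, c]" "{a, b, c} \<subseteq> {0, 1, 2}"
    and n: "[a, c, a] \<notin> factors w" "[b, a, b] \<notin> factors w" "[c, b, c] \<notin> factors w"
  shows False
proof -
  have "[b, c, a] \<in> factors w"
    using permutation_factor[OF w(1)] abc by auto
  then obtain s t where st: "length s = 3" "s @ [b, c, a] @ t \<in> factors w"
    using recurrent_extend[of w "[b, c, a]" 3] w(1) by (auto simp: ternary_square_free_def)
  then obtain x y z where s: "s = [x, y, z]"
    by (auto simp: numeral_3_eq_3 length_Suc_conv)
  have xyz: "[x, y, z, b, c, a] \<in> factors w"
    by (rule sublist_factors[OF st(2)], rule prefix_imp_sublist) (simp add: s)
  have sub: "u \<in> factors w" if "[x, y, z, b, c, a] = p @ u @ q" for p u q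
    using sublist_factors[OF xyz, of u] that by simp
  have "{x, y, z} \<subseteq> {a, b, c}"
    using set_factor[OF xyz] w(1) ternary_letters[OF abc] unfolding ternary_square_free_def by auto
  moreover have "z \<noteq> b" using square_factor[OF w, of "[x, y]" "[b]" "[c, a]"] xyz by auto
  moreover have "z \<noteq> c" using sub[of "[x, y]" "[z, b, c]" "[a]"] n(3) by auto
  ultimately have z: "z = a" by auto
  have "y \<noteq> a" using square_factor[OF w, of "[x]" "[a]" "[b, c, a]"] xyz z by auto
  moreover have "y \<noteq> b" using sub[of "[x]" "[y, z, b]" "[c, a]"] n(2) z by auto
  ultimately have y: "y = c" using \<open>{x, y, z} \<subseteq> {a, b, c}\<close> by auto
  have "x \<noteq> c" using square_factor[OF w, of "[]" "[c]" "[a, b, c, a]"] xyz y z by auto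
  moreover have "x \<noteq> a" using sub[of "[]" "[x, y, z]" "[b, c, a]"] n(1) y z by auto
  ultimately have "x = b" using \<open>{x, y, z} \<subseteq> {a, b, c}\<close> by auto
  then show False
    using square_factor[OF w, of "[]" "[b, c, a]" "[]"] xyz y z by auto
qed

text \<open>Read a factor \<open>xyx\<close> as an arrow from \<open>x\<close> to \<open>y\<close>.
  If every pair of letters carried an arrow, choosing one per pair would orient the triangle.
  Transitive orientations are excluded, so all arrows follow one cyclic orientation and none runs
  backwards; but \<open>no_cyclic_triple\<close> puts an arrow into each of the two cyclic
  orientations.\<close>

lemma missing_pair:
  assumes w: "ternary_square_free w" "avoids w upper_formula"
  shows "[1, 2, 1] \<notin> factors w \<and> [2, 1, 2] \<notin> factors w
    \<or> [2, 0, 2] \<notin> factors w \<and> [0, 2, 0] \<notin> factors w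
    \<or> [0, 1, 0] \<notin> factors w \<and> [1, 0, 1] \<notin> factors w"
proof -
  have *: "\<not> ([a, b, a] \<in> factors w \<and> [b, c, b] \<in> factors w \<and> [a, c, a] \<in> factors w)"
    if "distinct [a, b, c]" "{a, b, c} \<subseteq> {0, 1, 2}" for a b c
    using no_transitive_triple[OF w that] by blast
  have **: "[a, c, a] \<in> factors w \<or> [b, a, b] \<in> factors w \<or> [c, b, c] \<in> factors w"
    if "distinct [a, b, c]" "{a, b, c} \<subseteq> {0, 1, 2}" for a b c
    using no_cyclic_triple[OF w(1) that] by blast
  show ?thesis
    using *[of 0 1 2] *[of 0 2 1] *[of 1 0 2] *[of 1 2 0] *[of 2 0 1] *[of 2 1 0]
      **[of 0 1 2] **[of 0 2 1]
    by simp argo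
qed

subsection \<open>Desubstitution\<close>

definition block :: "nat \<Rightarrow> nat list" where
  "block x = (if x = 0 then [0, 2, 1, 0, 1, 2] else if x = 1 then [0, 1] else if x = 2 then [0, 2]
    else if x = 3 then [0, 1, 2] else if x = 4 then [0, 2, 1] else [])"

lemma morph_block: "morph block u = morph M2 (morph b5_morphism (morph b5_morphism u))"
proof -
  have "morph M2 (morph b5_morphism (b5_morphism x)) = block x" for x
    by (simp add: block_def M2_def b5_morphism_def)
  then show ?thesis by (simp add: morph_morph)
qed

definition b5_triples :: "nat list list" where
  "b5_triples = [[0, 1, 0], [0, 1, 2], [0, 4, 2], [1, 0, 1], [1, 0, 4], [1, 2, 3], [2, 1, 0], [2, 3, 0],
    [2, 3, 4], [3, 0, 1], [3, 4, 2], [4, 2, 1], [4, 2, 3]]"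

definition good :: "nat list \<Rightarrow> bool" where
  "good v \<longleftrightarrow> set v \<subseteq> {0..4} \<and> (\<forall>u. sublist u v \<longrightarrow> length u = 3 \<longrightarrow> u \<in> set b5_triples)"

lemma good_sublist: "good v \<Longrightarrow> sublist u v \<Longrightarrow> good u"
  unfolding good_def using sublist_order.order.trans set_mono_sublist by blast

text \<open>An executable form of the condition on triples in \<open>good\<close>, for use inside
  the enumerations.\<close>

fun good_triples :: "nat list \<Rightarrow> bool" where
  "good_triples (x # y # z # u) = (if [x, y, z] \<in> set b5_triples then good_triples (y # z # u) else False)"
| "good_triples u = True"

lemma good_imp_good_triples: "good u \<Longrightarrow> good_triples u"
proof (induction u rule: good_triples.induct)
  case (1 x y z u)
  have "sublist [x, y, z] (x # y # z # u)" "sublist (y # z # u) (x # y # z # u)"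
    by (simp_all add: sublist_Cons_right)
  then show ?case
    using 1 good_sublist[of _ "y # z # u"] by (auto simp: good_def)
qed auto

definition base_words :: "nat list list" where
  "base_words = grow (\<lambda>s. if take 2 s = [4, 3] then False
    else \<not> has_square (\<lambda>_. True) (morph block s)) [0, 1, 2, 3, 4] 6"

text \<open>One letter of context on the left and two on the right are enough to exclude every
  triple outside the list.\<close>

lemma base_words_middle: "list_all (\<lambda>u. take 3 (drop 1 u) \<in> set b5_triples) base_words"
  by code_simp

text \<open>Only squares containing \<open>0\<close> are excluded, because the morphism \<open>M\<^sub>2 \<circ> \<beta>\<close>, which is later
  applied to them, erases \<open>2\<close>.\<close>

definition step_words :: "nat list list" where
  "step_words = grow (\<lambda>s. if good_triples (morph b5_morphism s)
    then \<not> has_square (\<lambda>x. 0 \<in> set x) (morph b5_morphism (morph b5_morphism s)) else False)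
    [0, 1, 2, 3, 4] 6"

lemma step_words_middle: "list_all (\<lambda>u. take 3 (drop 1 u) \<in> set b5_triples) step_words"
  by code_simp

text \<open>The listed triples without \<open>0\<close> are \<open>123\<close>, \<open>234\<close>,
  \<open>342\<close>, \<open>421\<close> and \<open>423\<close>. None of them starts with
  \<open>21\<close>, so a word built from them either stops after \<open>421\<close> or runs round
  the cycle \<open>234\<close> and soon contains a square.\<close>

lemma zero_free_words:
  "grow (\<lambda>s. if good_triples s then \<not> square_prefix (\<lambda>_. True) s 0 s else False) [1, 2, 3, 4] 9 = []"
  by code_simp

definition ternary_words :: "nat list list" where
  "ternary_words = grow (\<lambda>s. if take 3 s = [1, 2, 1] \<or> take 3 s = [2, 1, 2] then False
    else \<not> square_prefix (\<lambda>_. True) s 0 s) [0, 1, 2] 4"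

text \<open>Two facts are read off this list for the decomposition into blocks: each window has a
  \<open>0\<close> among its first three letters, and after an initial \<open>0\<close> the next
  \<open>0\<close> comes two or three places later.\<close>

lemma ternary_words_subset: "list_all (\<lambda>u. u \<in> set
    [[0, 1, 0, 2], [0, 1, 2, 0], [0, 2, 0, 1], [0, 2, 1, 0], [1, 0, 1, 2], [1, 0, 2, 0], [1, 0, 2, 1],
     [1, 2, 0, 1], [1, 2, 0, 2], [2, 0, 1, 0], [2, 0, 1, 2], [2, 0, 2, 1], [2, 1, 0, 1], [2, 1, 0, 2]])
    ternary_words"
  by code_simp

lemma not_has_square:
  assumes "\<And>x. x \<noteq> [] \<Longrightarrow> Q x \<Longrightarrow> \<not> sublist (x @ x) u"
  shows "\<not> has_square Q u"
  using has_square_sound[of Q u] assms by blast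

lemma not_square_prefix:
  assumes "square_free u"
  shows "\<not> square_prefix Q u 0 u"
  using square_prefix_sound[of Q u 0 u] assms prefix_imp_sublist unfolding square_free_def drop_0 by blast

lemma base_window:
  assumes "length u = 6" "set u \<subseteq> {0..4}" "square_free (morph block u)" "\<not> sublist [4, 3] u"
  shows "take 3 (drop 1 u) \<in> set b5_triples"
proof -
  have "u \<in> set base_words"
    unfolding base_words_def
  proof (rule in_grow)
    show "set u \<subseteq> set [0, 1, 2, 3, 4]" using assms(2) by fastforce
    fix s assume "suffix s u" "s \<noteq> []"
    then have sub: "sublist s u" by (simp add: suffix_imp_sublist)
    have "take 2 s \<noteq> [4, 3]"
      using assms(4) sublist_order.order.trans[OF sublist_take[of 2 s] sub] by metis
    moreover have "\<not> has_square (\<lambda>_. True) (morph block s)"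
      using square_free_sublist[OF assms(3) sublist_morph[OF sub]]
      by (intro not_has_square) (simp add: square_free_def)
    ultimately show "if take 2 s = [4, 3] then False else \<not> has_square (\<lambda>_. True) (morph block s)"
      by simp
  qed (rule assms)
  then show ?thesis
    using base_words_middle by (simp only: list_all_iff)
qed

lemma step_window:
  assumes "length u = 6" "set u \<subseteq> {0..4}" "good (morph b5_morphism u)"
    and "\<And>x. 0 \<in> set x \<Longrightarrow> \<not> sublist (x @ x) (morph b5_morphism (morph b5_morphism u))"
  shows "take 3 (drop 1 u) \<in> set b5_triples"
proof -
  have "u \<in> set step_words"
    unfolding step_words_def
  proof (rule in_grow)
    show "set u \<subseteq> set [0, 1, 2, 3, 4]" using assms(2) by fastforce
    fix s assume "suffix s u" "s \<noteq> []"
    then have sub: "sublist s u" by (simp add: suffix_imp_sublist)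
    have "good_triples (morph b5_morphism s)"
      using good_sublist[OF assms(3) sublist_morph[OF sub]] by (rule good_imp_good_triples)
    moreover have "\<not> has_square (\<lambda>x. 0 \<in> set x) (morph b5_morphism (morph b5_morphism s))"
      using assms(4) sublist_order.order.trans[OF _ sublist_morph[OF sublist_morph[OF sub]]]
      by (intro not_has_square) blast
    ultimately show "if good_triples (morph b5_morphism s)
        then \<not> has_square (\<lambda>x. 0 \<in> set x) (morph b5_morphism (morph b5_morphism s)) else False"
      by simp
  qed (rule assms)
  then show ?thesis
    using step_words_middle by (simp only: list_all_iff)
qed

text \<open>A triple is certified only at places 1 to 3 of a window of six letters. Dropping one
  letter on the left and two on the right puts every remaining triple into such a place.\<close>

lemma good_trim:
  assumes "set v' \<subseteq> {0..4}" "v' = a # v @ [e, f]"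
    and win: "\<And>u. sublist u v' \<Longrightarrow> length u = 6 \<Longrightarrow> take 3 (drop 1 u) \<in> set b5_triples"
  shows "good v"
  unfolding good_def
proof (intro conjI allI impI)
  show "set v \<subseteq> {0..4}" using assms by auto
  fix u assume u: "sublist u v" "length u = 3"
  then obtain p q where v: "v = p @ u @ q" by (auto simp: sublist_def)
  obtain p' y where p': "a # p = p' @ [y]" by (metis neq_Nil_conv rev_exhaust)
  obtain g h q' where q': "q @ [e, f] = g # h # q'"
    by (cases q; cases "tl q") auto
  have "v' = p' @ ([y] @ u @ [g, h]) @ q'"
    using assms(2) v p' q' by (metis append.assoc append_Cons append_Nil)
  then have "take 3 (drop 1 ([y] @ u @ [g, h])) \<in> set b5_triples"
    using u(2) sublist_appendI[of "[y] @ u @ [g, h]" p' q'] by (intro win) simp_all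
  then show "u \<in> set b5_triples" using u(2) by simp
qed

lemma append_split:
  "xs @ ys = us @ vs \<Longrightarrow> length us \<le> length xs \<Longrightarrow> \<exists>t. xs = us @ t \<and> vs = t @ ys"
  by (auto simp: append_eq_append_conv2)

text \<open>The margins \<open>s\<close> and \<open>t\<close> absorb whatever \<open>p\<close> and
  \<open>q\<close> cut off, so \<open>u\<close> stays intact.\<close>

lemma sublist_core:
  assumes "sublist (s @ u @ t) (p @ m @ q)" "length p \<le> length s" "length q \<le> length t"
  shows "sublist u m"
proof -
  from assms(1) obtain x y where "(x @ s) @ (u @ t @ y) = p @ (m @ q)"
    by (auto simp: sublist_def)
  from append_split[OF this] obtain s' where s': "m @ q = s' @ u @ t @ y"
    using assms(2) by auto
  have "length m + length q = length s' + length u + length t + length y"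
    using arg_cong[OF s', of length] by simp
  then have "length (s' @ u) \<le> length m"
    using assms(3) by simp
  from append_split[OF _ this, of q "t @ y"] show ?thesis
    using s' by auto
qed

section \<open>Iterated images of code words and their lengths\<close>

text \<open>By \<open>morph_block\<close> this is \<open>M2\<close> after \<open>n + 2\<close>
  applications of \<open>b5_morphism\<close>. Unlike \<open>M2\<close>, \<open>block\<close> erases
  none of the letters \<open>0\<close> to \<open>4\<close>, which keeps images of non-empty code
  words non-empty.\<close>

definition iter_image :: "nat \<Rightarrow> nat list \<Rightarrow> nat list" where
  "iter_image n u = morph block ((morph b5_morphism ^^ n) u)"

lemma funpow_morph_append:
  fixes h :: "'a \<Rightarrow> 'a list"
  shows "(morph h ^^ n) (u @ v) = (morph h ^^ n) u @ (morph h ^^ n) v"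
  by (induction n) (simp_all add: morph_append)

lemma iter_image_append: "iter_image n (u @ v) = iter_image n u @ iter_image n v"
  by (simp add: iter_image_def funpow_morph_append morph_append)

lemma iter_image_Suc: "iter_image (Suc n) u = iter_image n (morph b5_morphism u)"
  by (simp add: iter_image_def funpow_swap1)

lemma iter_image_0: "iter_image 0 u = morph block u"
  by (simp add: iter_image_def)

lemma sublist_iter_image: "sublist u v \<Longrightarrow> sublist (iter_image n u) (iter_image n v)"
  unfolding sublist_def[of u] by (auto simp: iter_image_append)

lemma length_morph_le: "(\<And>x. length (h x) \<le> k) \<Longrightarrow> length (morph h u) \<le> k * length u"
proof (induction u)
  case (Cons x u)
  then show ?case using add_mono[OF Cons.prems[of x] Cons.IH] by simp
qed simp

lemma length_iter_image_le: "length (iter_image n u) \<le> 6 * 2 ^ n * length u"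
proof (induction n arbitrary: u)
  case 0
  show ?case unfolding iter_image_0 using length_morph_le[of block 6 u] by (simp add: block_def)
next
  case (Suc n)
  have "length (iter_image (Suc n) u) \<le> 6 * 2 ^ n * length (morph b5_morphism u)"
    unfolding iter_image_Suc by (rule Suc)
  also have "\<dots> \<le> 6 * 2 ^ n * (2 * length u)"
    by (intro mult_left_mono length_morph_le) (auto simp: b5_morphism_def)
  finally show ?case by simp
qed

lemma length_iter_image_ge: "set u \<subseteq> {0..4} \<Longrightarrow> length u \<le> length (iter_image n u)"
proof (induction n arbitrary: u)
  case 0
  then show ?case
  proof (induction u)
    case (Cons x u)
    then have "1 \<le> length (block x)" by (auto simp: block_def)
    with Cons show ?case by (simp add: iter_image_0)
  qed simp
next
  case (Suc n)
  then show ?case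
    unfolding iter_image_Suc using morph_b5_length morph_b5_letters by (meson order_trans)
qed

text \<open>The slowest letter is \<open>2\<close>, with successive images \<open>4\<close>,
  \<open>0\<close>, \<open>01\<close>; thus three applications of \<open>b5_morphism\<close> at
  least double the length.\<close>

lemma length_iter_image_ge_power: "set u \<subseteq> {0..4} \<Longrightarrow> 2 ^ k * length u \<le> length (iter_image (3 * k) u)"
proof (induction k arbitrary: u)
  case 0
  then show ?case using length_iter_image_ge[of u 0] by simp
next
  case (Suc k)
  let ?b = "morph b5_morphism"
  have "2 * length u \<le> length (?b (?b (?b u)))"
    using Suc.prems
  proof (induction u)
    case (Cons x u)
    then have "2 \<le> length (?b (?b (b5_morphism x)))" by (auto simp: b5_morphism_def)
    with Cons show ?case by (simp add: morph_append)
  qed simp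
  then have "2 ^ Suc k * length u \<le> 2 ^ k * length (?b (?b (?b u)))"
    by simp
  also have "\<dots> \<le> length (iter_image (3 * k) (?b (?b (?b u))))"
    using Suc.prems by (intro Suc.IH morph_b5_letters)
  also have "\<dots> = length (iter_image (3 * Suc k) u)"
    by (simp add: iter_image_Suc numeral_3_eq_3)
  finally show ?case .
qed

text \<open>Working with finite preimages \<open>v\<close> of arbitrarily long factors avoids desubstituting infinite
  words; the ends of \<open>v\<close> lost in each step are harmless, since recurrence puts \<open>u\<close> deep inside.\<close>

definition covered :: "(nat \<Rightarrow> nat) \<Rightarrow> nat \<Rightarrow> bool" where
  "covered w n \<longleftrightarrow> (\<forall>u\<in>factors w. \<exists>v. good v \<and> iter_image n v \<in> factors w \<and> sublist u (iter_image n v))"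

section \<open>One desubstitution step on code words\<close>

text \<open>The images \<open>01\<close>, \<open>23\<close>, \<open>4\<close>, \<open>21\<close>,
  \<open>0\<close> begin with \<open>0\<close>, \<open>2\<close> or \<open>4\<close>. After
  \<open>0\<close> or \<open>2\<close> the next letter decides which image it is, and the listed
  triples ensure that another such letter follows the image. A rest of at most two letters is too
  short to be read.\<close>

lemma desubstitute_aux:
  assumes "good v" "v = [] \<or> hd v \<in> {0, 2, 4}"
  shows "\<exists>v' q. v = morph b5_morphism v' @ q \<and> length q \<le> 2 \<and> set v' \<subseteq> {0..4}"
  using assms
proof (induction v rule: length_induct)
  case (1 v)
  show ?case
  proof (cases "length v \<le> 2")
    case True
    then show ?thesis by (intro exI[of _ "[]"] exI[of _ v]) simp
  next
    case False
    then obtain x y z r where v: "v = x # y # z # r"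
      by (cases v; cases "tl v"; cases "tl (tl v)") auto
    have *: "\<exists>v' q. v = morph b5_morphism v' @ q \<and> length q \<le> 2 \<and> set v' \<subseteq> {0..4}"
      if eq: "v = b5_morphism a @ t" and t: "a \<le> 4" "t \<noteq> []" "hd t \<in> {0, 2, 4}" "length t < length v" for a t
    proof -
      have "good t" using 1(2) eq by (auto intro: good_sublist)
      then obtain v' q where "t = morph b5_morphism v' @ q" "length q \<le> 2" "set v' \<subseteq> {0..4}"
        using 1(1) t by blast
      then show ?thesis
        using eq t(1) by (intro exI[of _ "a # v'"] exI[of _ q]) auto
    qed
    have "sublist [x, y, z] v" unfolding v by (simp add: sublist_Cons_right)
    then have "[x, y, z] \<in> set b5_triples" using 1(2) by (simp add: good_def)
    then consider "x = 0" "y = 1" "z \<in> {0, 2}" | "x = 0" "y = 4" | "x = 2" "y = 1" "z = 0"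
      | "x = 2" "y = 3" "z \<in> {0, 4}" | "x = 4" "y = 2"
      using 1(3) v by (auto simp: b5_triples_def)
    then show ?thesis
    proof cases
      case 1 then show ?thesis using v by (intro *[of 0 "z # r"]) (auto simp: b5_morphism_def)
    next
      case 2 then show ?thesis using v by (intro *[of 4 "y # z # r"]) (auto simp: b5_morphism_def)
    next
      case 3 then show ?thesis using v by (intro *[of 3 "z # r"]) (auto simp: b5_morphism_def)
    next
      case 4 then show ?thesis using v by (intro *[of 1 "z # r"]) (auto simp: b5_morphism_def)
    next
      case 5 then show ?thesis using v by (intro *[of 2 "y # z # r"]) (auto simp: b5_morphism_def)
    qed
  qed
qed

text \<open>In the listed triples \<open>1\<close> and \<open>3\<close> are followed only by
  \<open>0\<close>, \<open>2\<close> or \<open>4\<close>, so skipping one letter reaches the start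
  of an image.\<close>

lemma desubstitute:
  assumes "good v" "length v \<ge> 3"
  shows "\<exists>p v' q. v = p @ morph b5_morphism v' @ q \<and> length p \<le> 1 \<and> length q \<le> 2 \<and> set v' \<subseteq> {0..4}"
proof -
  obtain x y z r where v: "v = x # y # z # r"
    using assms(2) by (cases v; cases "tl v"; cases "tl (tl v)") auto
  show ?thesis
  proof (cases "x \<in> {0, 2, 4}")
    case True
    then obtain v' q where "v = morph b5_morphism v' @ q" "length q \<le> 2" "set v' \<subseteq> {0..4}"
      using desubstitute_aux[OF assms(1)] v by auto
    then show ?thesis
      by (intro exI[of _ "[]"] exI[of _ v'] exI[of _ q]) simp
  next
    case False
    have "sublist [x, y, z] v" unfolding v by (simp add: sublist_Cons_right)
    then have "[x, y, z] \<in> set b5_triples" using assms(1) by (simp add: good_def)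
    then have "y \<in> {0, 2, 4}" using False by (auto simp: b5_triples_def)
    moreover have "good (y # z # r)"
      using assms(1) unfolding v by (rule good_sublist) (simp add: sublist_Cons_right)
    ultimately obtain v' q where "y # z # r = morph b5_morphism v' @ q" "length q \<le> 2" "set v' \<subseteq> {0..4}"
      using desubstitute_aux[of "y # z # r"] by auto
    then show ?thesis
      using v by (intro exI[of _ "[x]"] exI[of _ v'] exI[of _ q]) simp
  qed
qed

lemma trim_ends:
  assumes "length v \<ge> 3"
  obtains a m e f where "v = a # m @ [e, f]"
proof -
  obtain a r where "v = a # r" using assms by (cases v) auto
  moreover obtain r' f where "r = r' @ [f]" using assms calculation by (cases r rule: rev_exhaust) auto
  moreover obtain m e where "r' = m @ [e]" using assms calculation by (cases r' rule: rev_exhaust) auto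
  ultimately show ?thesis using that by simp
qed

lemma zero_in_funpow: "0 \<in> set x \<Longrightarrow> 0 \<in> set ((morph b5_morphism ^^ n) x)"
proof (induction n)
  case (Suc n)
  then show ?case by (force simp: morph_def b5_morphism_def)
qed simp

lemma iter_image_square:
  assumes "sublist (x @ x) (morph b5_morphism (morph b5_morphism u))" "0 \<in> set x"
  shows "\<not> square_free (iter_image (Suc n) u)"
proof -
  \<comment> \<open>\<open>G\<close> performs the remaining \<open>n + 1\<close> applications and
    \<open>M2\<close>; two of the \<open>n + 3\<close> applications are already carried out in the
    word that contains the square. A \<open>0\<close> in \<open>x\<close> survives all of them, so
    \<open>G x\<close> is not empty.\<close>
  define G where "G y = morph M2 ((morph b5_morphism ^^ Suc n) y)" for y
  have G_append: "G (y @ z) = G y @ G z" for y z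
    by (simp only: G_def funpow_morph_append morph_append)
  have "iter_image (Suc n) u = G (morph b5_morphism (morph b5_morphism u))"
    by (simp add: iter_image_def G_def morph_block funpow_swap1)
  moreover obtain p q where "morph b5_morphism (morph b5_morphism u) = p @ x @ x @ q"
    using assms(1) by (auto simp: sublist_def)
  moreover have "G x \<noteq> []"
  proof -
    have "0 \<in> set (G x)"
      using zero_in_funpow[OF assms(2), of "Suc n"] unfolding G_def
      by (force simp: morph_def M2_def simp del: funpow.simps)
    then show ?thesis by auto
  qed
  ultimately show ?thesis
    using not_square_free[of "G x" "G p" "G q"] by (simp add: G_append)
qed

text \<open>A code word at level \<open>n\<close> is desubstituted once. The preimage has only
  listed triples away from its ends, because its windows have good images and a square with a
  \<open>0\<close> in a second image would produce a square in \<open>w\<close>.\<close>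

lemma covered_Suc:
  assumes w: "ternary_square_free w" and "covered w n"
  shows "covered w (Suc n)"
  unfolding covered_def
proof
  fix u assume "u \<in> factors w"
  \<comment> \<open>At most six code letters are lost at either end (\<open>p\<close> and the image
    of \<open>a\<close>, or the images of \<open>e\<close>, \<open>f\<close> and \<open>q\<close>),
    each contributing at most \<open>6 * 2 ^ n\<close> letters.\<close>
  define K :: nat where "K = 6 * 2 ^ n * 6"
  obtain s t where st: "length s = K" "length t = K" "s @ u @ t \<in> factors w"
    using recurrent_extend[of w u K] \<open>u \<in> factors w\<close> w by (auto simp: ternary_square_free_def)
  then obtain v where v: "good v" "iter_image n v \<in> factors w" "sublist (s @ u @ t) (iter_image n v)"
    using assms(2) unfolding covered_def by blast
  \<comment> \<open>The two margins alone have \<open>2 * K\<close> letters. Twelve code letters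
    leave enough of \<open>v'\<close> to trim three letters.\<close>
  have "12 \<le> length v"
  proof -
    have "6 * 2 ^ n * 12 \<le> length (iter_image n v)"
      using sublist_length_le[OF v(3)] st by (simp add: K_def)
    also have "\<dots> \<le> 6 * 2 ^ n * length v" by (rule length_iter_image_le)
    finally show ?thesis by simp
  qed
  then obtain p v' q where v': "v = p @ morph b5_morphism v' @ q" "length p \<le> 1" "length q \<le> 2"
      "set v' \<subseteq> {0..4}"
    using desubstitute[OF v(1)] by auto
  have "length (morph b5_morphism v') \<le> 2 * length v'"
    by (rule length_morph_le) (simp add: b5_morphism_def)
  then have "3 \<le> length v'"
    using v' \<open>12 \<le> length v\<close> by simp
  then obtain a m e f where m: "v' = a # m @ [e, f]"
    by (rule trim_ends)
  have sub: "sublist (iter_image (Suc n) y) (iter_image n v)" if "sublist y v'" for y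
    unfolding iter_image_Suc v'(1) using sublist_morph[OF that] sublist_iter_image sublist_append_leftI sublist_append_rightI
    by (metis sublist_order.order.trans)
  have "good m"
  proof (rule good_trim[OF v'(4) m])
    fix y assume y: "sublist y v'" "length y = 6"
    show "take 3 (drop 1 y) \<in> set b5_triples"
    proof (rule step_window[OF y(2)])
      show "set y \<subseteq> {0..4}" using set_mono_sublist[OF y(1)] v'(4) by blast
      show "good (morph b5_morphism y)"
        using v(1) sublist_morph[OF y(1), of b5_morphism] v'(1) good_sublist
        by (metis sublist_appendI)
      fix x :: "nat list" assume "0 \<in> set x"
      then show "\<not> sublist (x @ x) (morph b5_morphism (morph b5_morphism y))"
        using iter_image_square sub[OF y(1)] v(2) w sublist_factors unfolding ternary_square_free_def by blast
    qed
  qed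
  moreover have "iter_image (Suc n) m \<in> factors w"
    using sub[of m] m v(2) sublist_factors by (metis append_Cons append_Nil sublist_appendI)
  moreover have "sublist u (iter_image (Suc n) m)"
  proof (rule sublist_core)
    have "iter_image n v = iter_image n (p @ b5_morphism a) @ iter_image (Suc n) m @ iter_image n (morph b5_morphism [e, f] @ q)"
      unfolding v'(1) m iter_image_Suc by (simp add: iter_image_append morph_append)
    then show "sublist (s @ u @ t) (iter_image n (p @ b5_morphism a) @ iter_image (Suc n) m @ iter_image n (morph b5_morphism [e, f] @ q))"
      using v(3) by simp
    have "length (p @ b5_morphism a) \<le> 6" using v'(2) by (simp add: b5_morphism_def)
    then show "length (iter_image n (p @ b5_morphism a)) \<le> length s"
      using length_iter_image_le[of n "p @ b5_morphism a"] mult_left_mono[of _ 6 "6 * 2 ^ n :: nat"]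
      unfolding st K_def by (meson le_trans zero_le)
    have "length (morph b5_morphism [e, f] @ q) \<le> 6" using v'(3) by (simp add: b5_morphism_def)
    then show "length (iter_image n (morph b5_morphism [e, f] @ q)) \<le> length t"
      using length_iter_image_le[of n "morph b5_morphism [e, f] @ q"] mult_left_mono[of _ 6 "6 * 2 ^ n :: nat"]
      unfolding st K_def by (meson le_trans zero_le)
  qed
  ultimately show "\<exists>v. good v \<and> iter_image (Suc n) v \<in> factors w \<and> sublist u (iter_image (Suc n) v)"
    by blast
qed

section \<open>Decomposition of the ternary word into blocks\<close>

text \<open>The block \<open>021012\<close> of \<open>0\<close> is the concatenation of the blocks of \<open>4\<close> and \<open>3\<close>; replacing \<open>43\<close> by
  \<open>0\<close> makes the decomposition into blocks unique.\<close>

fun merge :: "nat list \<Rightarrow> nat list" where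
  "merge (x # y # u) = (if x = 4 \<and> y = 3 then 0 # merge u else x # merge (y # u))"
| "merge u = u"

lemma morph_block_merge: "morph block (merge u) = morph block u"
  by (induction u rule: merge.induct) (auto simp: block_def)

lemma set_merge: "set u \<subseteq> {0..4} \<Longrightarrow> set (merge u) \<subseteq> {0..4}"
  by (induction u rule: merge.induct) auto

lemma hd_merge: "merge (x # u) \<noteq> [] \<and> hd (merge (x # u)) \<in> {x, 0}"
  by (cases u) auto

text \<open>The head of \<open>merge (y # u)\<close> is \<open>y\<close> or \<open>0\<close>, so no
  new \<open>3\<close> can appear behind a \<open>4\<close> that is kept.\<close>

lemma merge_avoids_43: "\<not> sublist [4, 3] (merge u)"
proof (induction u rule: merge.induct)
  case (1 x y u)
  show ?case
  proof (cases "x = 4 \<and> y = 3")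
    case True
    then show ?thesis using 1 by (auto simp: sublist_Cons_right)
  next
    case False
    obtain k ks where "merge (y # u) = k # ks" "k \<in> {y, 0}"
      using hd_merge[of y u] by (cases "merge (y # u)") auto
    then show ?thesis
      using 1(2)[OF False] False by (auto simp: sublist_Cons_right)
  qed
qed (auto simp: sublist_Cons_right)

definition ternary_allowed :: "nat list \<Rightarrow> bool" where
  "ternary_allowed z \<longleftrightarrow> square_free z \<and> set z \<subseteq> {0, 1, 2} \<and> \<not> sublist [1, 2, 1] z \<and> \<not> sublist [2, 1, 2] z"

lemma ternary_allowed_sublist: "ternary_allowed z \<Longrightarrow> sublist u z \<Longrightarrow> ternary_allowed u"
  unfolding ternary_allowed_def
  by (meson square_free_sublist set_mono_sublist subset_trans sublist_order.order.trans)

lemma ternary_window: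
  assumes "ternary_allowed (a # b # c # d # r)"
  shows "[a, b, c, d] \<in> set
    [[0, 1, 0, 2], [0, 1, 2, 0], [0, 2, 0, 1], [0, 2, 1, 0], [1, 0, 1, 2], [1, 0, 2, 0], [1, 0, 2, 1],
     [1, 2, 0, 1], [1, 2, 0, 2], [2, 0, 1, 0], [2, 0, 1, 2], [2, 0, 2, 1], [2, 1, 0, 1], [2, 1, 0, 2]]"
proof -
  have allowed: "ternary_allowed [a, b, c, d]"
    using assms by (rule ternary_allowed_sublist) (simp add: prefix_imp_sublist)
  have "[a, b, c, d] \<in> set ternary_words"
    unfolding ternary_words_def
  proof (rule in_grow)
    show "set [a, b, c, d] \<subseteq> set [0, 1, 2]"
      using allowed by (auto simp: ternary_allowed_def)
    fix s assume "suffix s [a, b, c, d]" "s \<noteq> []"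
    then have s: "ternary_allowed s"
      using ternary_allowed_sublist[OF allowed] by (simp add: suffix_imp_sublist)
    have "take 3 s \<noteq> [1, 2, 1]" "take 3 s \<noteq> [2, 1, 2]"
      using s sublist_take[of 3 s] unfolding ternary_allowed_def by metis+
    moreover have "\<not> square_prefix (\<lambda>_. True) s 0 s"
      using s by (intro not_square_prefix) (simp add: ternary_allowed_def)
    ultimately show "if take 3 s = [1, 2, 1] \<or> take 3 s = [2, 1, 2] then False
        else \<not> square_prefix (\<lambda>_. True) s 0 s"
      by simp
  qed simp
  then show ?thesis
    using ternary_words_subset by (simp only: list_all_iff)
qed

text \<open>The word is cut before each \<open>0\<close>, which yields the blocks of
  \<open>1\<close>, \<open>2\<close>, \<open>3\<close> and \<open>4\<close>; the letter
  \<open>0\<close> enters the code word later, through \<open>merge\<close>. A rest of at most three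
  letters is too short for a window.\<close>

lemma parse_blocks_aux:
  assumes "ternary_allowed z" "z = [] \<or> hd z = 0"
  shows "\<exists>v q. z = morph block v @ q \<and> length q \<le> 3 \<and> set v \<subseteq> {0..4}"
  using assms
proof (induction z rule: length_induct)
  case (1 z)
  show ?case
  proof (cases "length z \<le> 3")
    case True
    then show ?thesis by (intro exI[of _ "[]"] exI[of _ z]) simp
  next
    case False
    then obtain a b c d r where z: "z = a # b # c # d # r"
      by (cases z; cases "tl z"; cases "tl (tl z)"; cases "tl (tl (tl z))") auto
    have *: "\<exists>v q. z = morph block v @ q \<and> length q \<le> 3 \<and> set v \<subseteq> {0..4}"
      if eq: "z = block x @ t" and t: "x \<le> 4" "t \<noteq> []" "hd t = 0" "length t < length z" for x t
    proof -
      have "ternary_allowed t" using 1(2) eq by (auto intro: ternary_allowed_sublist)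
      then obtain v q where "t = morph block v @ q" "length q \<le> 3" "set v \<subseteq> {0..4}"
        using 1(1) t by blast
      then show ?thesis
        using eq t(1) by (intro exI[of _ "x # v"] exI[of _ q]) auto
    qed
    consider "a = 0" "b = 1" "c = 0" | "a = 0" "b = 1" "c = 2" "d = 0" | "a = 0" "b = 2" "c = 0"
      | "a = 0" "b = 2" "c = 1" "d = 0"
      using ternary_window[of a b c d r] 1(2,3) unfolding z by auto
    then show ?thesis
    proof cases
      case 1 then show ?thesis using z by (intro *[of 1 "c # d # r"]) (auto simp: block_def)
    next
      case 2 then show ?thesis using z by (intro *[of 3 "d # r"]) (auto simp: block_def)
    next
      case 3 then show ?thesis using z by (intro *[of 2 "c # d # r"]) (auto simp: block_def)
    next
      case 4 then show ?thesis using z by (intro *[of 4 "d # r"]) (auto simp: block_def)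
    qed
  qed
qed

lemma parse_blocks:
  assumes "ternary_allowed z" "length z \<ge> 4"
  shows "\<exists>p v q. z = p @ morph block v @ q \<and> length p \<le> 2 \<and> length q \<le> 3 \<and> set v \<subseteq> {0..4}
    \<and> \<not> sublist [4, 3] v"
proof -
  obtain a b c d r where z: "z = a # b # c # d # r"
    using assms(2) by (cases z; cases "tl z"; cases "tl (tl z)"; cases "tl (tl (tl z))") auto
  have "a = 0 \<or> b = 0 \<or> c = 0"
    using ternary_window[of a b c d r] assms(1) unfolding z by auto
  then obtain p t where pt: "z = p @ t" "length p \<le> 2" "t \<noteq> []" "hd t = 0"
  proof (elim disjE)
    assume "a = 0" then show ?thesis using that[of "[]" z] z by simp
  next
    assume "b = 0" then show ?thesis using that[of "[a]" "b # c # d # r"] z by simp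
  next
    assume "c = 0" then show ?thesis using that[of "[a, b]" "c # d # r"] z by simp
  qed
  have "ternary_allowed t" using assms(1) pt(1) by (auto intro: ternary_allowed_sublist)
  then obtain v q where "t = morph block v @ q" "length q \<le> 3" "set v \<subseteq> {0..4}"
    using parse_blocks_aux[of t] pt(4) by auto
  then show ?thesis
    using pt set_merge[of v] merge_avoids_43[of v]
    by (intro exI[of _ p] exI[of _ "merge v"] exI[of _ q]) (simp add: morph_block_merge)
qed

lemma covered_0:
  assumes w: "ternary_square_free w" and n: "[1, 2, 1] \<notin> factors w" "[2, 1, 2] \<notin> factors w"
  shows "covered w 0"
  unfolding covered_def iter_image_0
proof
  fix u assume "u \<in> factors w"
  \<comment> \<open>The losses are at most \<open>2 + 6\<close> letters on the left and
    \<open>12 + 3\<close> on the right; both fit into 20.\<close>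
  obtain s t where st: "length s = 20" "length t = 20" "s @ u @ t \<in> factors w"
    using recurrent_extend[of w u 20] \<open>u \<in> factors w\<close> w by (auto simp: ternary_square_free_def)
  define z where "z = s @ u @ t"
  have z: "z \<in> factors w" "length z \<ge> 40" using st by (simp_all add: z_def)
  have "ternary_allowed z"
    unfolding ternary_allowed_def
  proof (intro conjI)
    show "square_free z" using w z(1) by (simp add: ternary_square_free_def)
    show "set z \<subseteq> {0, 1, 2}"
      using w set_factor[OF z(1)] unfolding ternary_square_free_def by (meson subset_trans)
    show "\<not> sublist [1, 2, 1] z" using n(1) sublist_factors[OF z(1)] by metis
    show "\<not> sublist [2, 1, 2] z" using n(2) sublist_factors[OF z(1)] by metis
  qed
  then obtain p v q where v: "z = p @ morph block v @ q" "length p \<le> 2" "length q \<le> 3" "set v \<subseteq> {0..4}"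
      "\<not> sublist [4, 3] v"
    using parse_blocks[of z] z(2) by auto
  have "length (morph block v) \<le> 6 * length v"
    by (rule length_morph_le) (simp add: block_def)
  then have "3 \<le> length v" using v z(2) by simp
  then obtain a m e f where m: "v = a # m @ [e, f]"
    by (rule trim_ends)
  have sub: "morph block y \<in> factors w" if "sublist y v" for y
  proof -
    have "sublist (morph block y) z"
      unfolding v(1) by (rule sublist_order.order.trans[OF sublist_morph[OF that] sublist_appendI])
    then show ?thesis by (rule sublist_factors[OF z(1)])
  qed
  have "good m"
  proof (rule good_trim[OF v(4) m])
    fix y assume y: "sublist y v" "length y = 6"
    show "take 3 (drop 1 y) \<in> set b5_triples"
    proof (rule base_window[OF y(2)])
      show "set y \<subseteq> {0..4}" using set_mono_sublist[OF y(1)] v(4) by blast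
      show "square_free (morph block y)" using sub[OF y(1)] w by (simp add: ternary_square_free_def)
      show "\<not> sublist [4, 3] y" using v(5) sublist_order.order.trans[OF _ y(1)] by blast
    qed
  qed
  moreover have "morph block m \<in> factors w"
    using sublist_appendI[of m "[a]" "[e, f]"] m by (intro sub) simp
  moreover have "sublist u (morph block m)"
  proof (rule sublist_core)
    show "sublist (s @ u @ t) ((p @ block a) @ morph block m @ (morph block [e, f] @ q))"
      using v(1) m by (simp add: z_def[symmetric] morph_append)
    show "length (p @ block a) \<le> length s" using v(2) st by (simp add: block_def)
    show "length (morph block [e, f] @ q) \<le> length t" using v(3) st by (simp add: block_def)
  qed
  ultimately show "\<exists>v. good v \<and> morph block v \<in> factors w \<and> sublist u (morph block v)"
    by blast
qed

lemma covered:
  assumes "ternary_square_free w" "[1, 2, 1] \<notin> factors w" "[2, 1, 2] \<notin> factors w"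
  shows "covered w n"
proof (induction n)
  case 0
  show ?case by (rule covered_0[OF assms])
next
  case (Suc n)
  then show ?case by (rule covered_Suc[OF assms(1)])
qed

subsection \<open>Thue's characterization of \<open>w\<^sub>3\<close>\<close>

lemma factors_eq_prefixes:
  assumes "\<And>k. map x [0..<length (P k)] = P k" "\<And>k. k \<le> length (P k)"
  shows "factors x = {u. \<exists>k. sublist u (P k)}"
proof (intro equalityI subsetI)
  fix u assume "u \<in> factors x"
  then obtain i where i: "map x [i..<i + length u] = u"
    by (auto simp: factors_def occurs_at_def)
  let ?P = "P (i + length u)"
  have "[0..<length ?P] = [0..<i] @ [i..<i + length u] @ [i + length u..<length ?P]"
    using assms(2)[of "i + length u"] upt_split[of 0 i "length ?P"] upt_split[of i "i + length u" "length ?P"]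
    by simp
  then have "?P = map x [0..<i] @ u @ map x [i + length u..<length ?P]"
    using assms(1)[of "i + length u"] i by (metis map_append)
  then show "u \<in> {u. \<exists>k. sublist u (P k)}"
    by (metis mem_Collect_eq sublist_appendI)
next
  fix u assume "u \<in> {u. \<exists>k. sublist u (P k)}"
  then obtain k where "sublist u (P k)" by blast
  then show "u \<in> factors x"
    using sublist_factors[of "P k" x u] map_upt_in_factors[of x 0 "length (P k)"] assms(1)[of k] by simp
qed

lemma iter_image_b5_iter: "iter_image n (b5_iter m) = iter_image (n + m) [0]"
  by (simp add: iter_image_def b5_iter_def funpow_add)

text \<open>\<open>iter_image k [0]\<close> is \<open>M2\<close> of the prefix
  \<open>b5_iter (k + 2)\<close> of \<open>b5\<close>, hence a prefix of \<open>w3\<close>. Although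
  \<open>M2\<close> erases \<open>4\<close>, these prefixes grow without bound because they are
  products of non-empty blocks.\<close>

lemma factors_w3: "factors w3 = {u. \<exists>k. sublist u (iter_image k [0])}"
proof (rule factors_eq_prefixes)
  fix k
  have iter_image: "iter_image k [0] = morph M2 (b5_iter (Suc (Suc k)))"
    by (simp add: iter_image_def morph_block b5_iter_def)
  show "map w3 [0..<length (iter_image k [0])] = iter_image k [0]"
  proof (rule nth_equalityI)
    fix i assume "i < length (map w3 [0..<length (iter_image k [0])])"
    then have i: "i < length (morph M2 (map b5 [0..<length (b5_iter (Suc (Suc k)))]))"
      unfolding b5_prefix iter_image by simp
    show "map w3 [0..<length (iter_image k [0])] ! i = iter_image k [0] ! i"
      using morph_inf_nth[OF i] i unfolding b5_prefix iter_image w3_def by simp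
  qed simp
  have "length (b5_iter k) \<le> length (morph block (b5_iter k))"
    using length_iter_image_ge[of "b5_iter k" 0] b5_iter_shape[of k] by (simp add: iter_image_0)
  then show "k \<le> length (iter_image k [0])"
    using b5_iter_shape[of k] by (simp add: iter_image_def b5_iter_def)
qed

lemma b5_triples_in_b5_iter: "list_all (\<lambda>u. sublist u (b5_iter 6)) b5_triples"
  by code_simp

lemma iter_image_triple_factor_w3:
  assumes "y \<in> set b5_triples"
  shows "iter_image n y \<in> factors w3"
proof -
  have "sublist y (b5_iter 6)" using b5_triples_in_b5_iter assms by (simp only: list_all_iff)
  then have "sublist (iter_image n y) (iter_image (n + 6) [0])" using sublist_iter_image iter_image_b5_iter by metis
  then show ?thesis unfolding factors_w3 by blast
qed

text \<open>As \<open>u\<close> is no longer than the image of any letter, some occurrence of it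
  lies within the images of two consecutive letters; a third letter completes the triple.\<close>

lemma sublist_triple:
  assumes "sublist u (iter_image n v)" "length v \<ge> 3" "\<And>x. x \<in> set v \<Longrightarrow> length u \<le> length (iter_image n [x])"
  shows "\<exists>y. sublist y v \<and> length y = 3 \<and> sublist u (iter_image n y)"
  using assms
proof (induction v)
  case (Cons a v)
  show ?case
  proof (cases "length v \<ge> 3")
    case False
    then have "length (a # v) = 3" using Cons.prems(2) by simp
    then show ?thesis using Cons.prems(1) by blast
  next
    case True
    then obtain b c r where v: "v = b # c # r"
      by (cases v; cases "tl v") auto
    have abc: "sublist [a, b, c] (a # v)" "iter_image n [a, b, c] = iter_image n [a] @ iter_image n [b] @ iter_image n [c]"
      "iter_image n (a # v) = iter_image n [a] @ iter_image n v" "iter_image n v = iter_image n [b] @ iter_image n (c # r)"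
      using iter_image_append[of n "[a]" "[b, c]"] iter_image_append[of n "[b]" "[c]"] iter_image_append[of n "[a]" v]
        iter_image_append[of n "[b]" "c # r"]
      by (simp_all add: v prefix_imp_sublist)
    consider "sublist u (iter_image n [a])" | "sublist u (iter_image n v)"
      | u1 u2 where "u = u1 @ u2" "suffix u1 (iter_image n [a])" "prefix u2 (iter_image n v)"
      using Cons.prems(1) unfolding abc(3) sublist_append by blast
    then show ?thesis
    proof cases
      case 1
      then have "sublist u (iter_image n [a, b, c])"
        unfolding abc(2) by (rule sublist_order.order.trans) (rule sublist_append_rightI)
      then show ?thesis using abc(1) by (intro exI[of _ "[a, b, c]"]) simp
    next
      case 2
      from Cons.IH[OF this True] Cons.prems(3) obtain y
        where y: "sublist y v" "length y = 3" "sublist u (iter_image n y)" by auto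
      have "sublist y (a # v)" using y(1) by (simp add: sublist_Cons_right)
      with y show ?thesis by blast
    next
      case 3
      have "length u2 \<le> length (iter_image n [b])" using Cons.prems(3)[of b] 3(1) v by simp
      then have "prefix u2 (iter_image n [b])"
        by (rule prefix_length_prefix[OF 3(3)[unfolded abc(4)] prefixI[OF refl]])
      then obtain s t where st: "iter_image n [a] = s @ u1" "iter_image n [b] = u2 @ t"
        using 3(2) by (auto simp: suffix_def prefix_def)
      have "iter_image n [a, b, c] = s @ u @ t @ iter_image n [c]" by (simp add: abc(2) st 3(1))
      then have "sublist u (iter_image n [a, b, c])" by (metis sublist_appendI)
      then show ?thesis using abc(1) by (intro exI[of _ "[a, b, c]"]) simp
    qed
  qed
qed simp

lemma good_contains_zero:
  assumes "good v" "square_free v" "length v \<ge> 9"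
  shows "0 \<in> set v"
proof (rule ccontr)
  assume 0: "0 \<notin> set v"
  let ?P = "\<lambda>s. if good_triples s then \<not> square_prefix (\<lambda>_. True) s 0 s else False"
  have "take 9 v \<in> set (grow ?P [1, 2, 3, 4] 9)"
  proof (rule in_grow)
    show "length (take 9 v) = 9" using assms(3) by simp
    have "x \<in> {1, 2, 3, 4}" if "x \<in> set v" for x
    proof -
      have "x \<noteq> 0" using 0 that by metis
      moreover have "x \<le> 4" using assms(1) that by (auto simp: good_def)
      ultimately show ?thesis by auto
    qed
    then show "set (take 9 v) \<subseteq> set [1, 2, 3, 4]"
      by (auto dest!: in_set_takeD)
    fix s assume "suffix s (take 9 v)" "s \<noteq> []"
    then have "sublist s v"
      by (intro sublist_order.order.trans[OF suffix_imp_sublist sublist_take])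
    then show "?P s"
      using good_imp_good_triples[of s] not_square_prefix[of s] good_sublist[OF assms(1)]
        square_free_sublist[OF assms(2)] by simp
  qed
  then show False unfolding zero_free_words by simp
qed

lemma square_free_iter_image_imp:
  assumes "square_free (iter_image n v)" "set v \<subseteq> {0..4}"
  shows "square_free v"
  unfolding square_free_def
proof (intro allI impI notI)
  fix x assume x: "x \<noteq> []" "sublist (x @ x) v"
  have "set x \<subseteq> {0..4}" using set_mono_sublist[OF x(2)] assms(2) by auto
  then have "iter_image n x \<noteq> []" using length_iter_image_ge[of x n] x(1) by auto
  moreover have "sublist (iter_image n x @ iter_image n x) (iter_image n v)"
    using sublist_iter_image[OF x(2), of n] by (simp add: iter_image_append)
  ultimately show False using assms(1) by (auto simp: square_free_def)
qed

theorem thue_121_212: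
  assumes w: "ternary_square_free w" and n: "[1, 2, 1] \<notin> factors w" "[2, 1, 2] \<notin> factors w"
  shows "factors w = factors w3"
proof (intro equalityI subsetI)
  have long: "\<exists>v. good v \<and> iter_image n v \<in> factors w \<and> sublist u (iter_image n v) \<and> length v \<ge> l"
    if u: "u \<in> factors w" for u :: "nat list" and n l :: nat
  proof -
    obtain s t where st: "length s = 6 * 2 ^ n * l" "s @ u @ t \<in> factors w"
      using recurrent_extend[OF _ u, of "6 * 2 ^ n * l"] w by (auto simp: ternary_square_free_def)
    then obtain v where v: "good v" "iter_image n v \<in> factors w" "sublist (s @ u @ t) (iter_image n v)"
      using covered[OF assms, of n] unfolding covered_def by blast
    have "6 * 2 ^ n * l \<le> length (iter_image n v)"
      using sublist_length_le[OF v(3)] st(1) by simp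
    also have "\<dots> \<le> 6 * 2 ^ n * length v" by (rule length_iter_image_le)
    finally have "l \<le> length v" by simp
    moreover have "sublist u (iter_image n v)"
      using sublist_order.order.trans[OF sublist_appendI v(3)] .
    ultimately show ?thesis using v by blast
  qed
  {
    fix u assume u: "u \<in> factors w"
    \<comment> \<open>At level \<open>3 * length u\<close> each letter has an image of length at
      least \<open>2 ^ length u\<close>, which exceeds the length of \<open>u\<close>.\<close>
    obtain v where v: "good v" "sublist u (iter_image (3 * length u) v)" "length v \<ge> 3"
      using long[OF u, of "3 * length u" 3] by blast
    have "length u \<le> length (iter_image (3 * length u) [x])" if "x \<in> set v" for x
    proof -
      have "length u \<le> 2 ^ length u * length [x]" using less_exp[of "length u"] by simp
      also have "\<dots> \<le> length (iter_image (3 * length u) [x])"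
        using that v(1) by (intro length_iter_image_ge_power) (auto simp: good_def)
      finally show ?thesis .
    qed
    then obtain y where y: "sublist y v" "length y = 3" "sublist u (iter_image (3 * length u) y)"
      using sublist_triple[OF v(2,3)] by blast
    then have "y \<in> set b5_triples" using v(1) by (simp add: good_def)
    from sublist_factors[OF iter_image_triple_factor_w3[OF this] y(3)] show "u \<in> factors w3" .
  next
    fix u assume "u \<in> factors w3"
    then obtain k where k: "sublist u (iter_image k [0])" unfolding factors_w3 by blast
    have "[] \<in> factors w" using map_upt_in_factors[of w 0 0] by simp
    \<comment> \<open>A square-free good code word of length 9 must contain \<open>0\<close>, so the
      image of \<open>0\<close> at level \<open>k\<close> appears in \<open>w\<close>.\<close>
    then obtain v where v: "good v" "iter_image k v \<in> factors w" "length v \<ge> 9"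
      using long[of "[]" k 9] by blast
    have "square_free v"
      using v(1,2) w by (intro square_free_iter_image_imp[of k v]) (auto simp: ternary_square_free_def good_def)
    from good_contains_zero[OF v(1) this v(3)] have "0 \<in> set v" .
    then obtain p q where "v = p @ [0] @ q" by (auto dest: split_list)
    then have "sublist [0] v" using sublist_appendI[of "[0]" p q] by simp
    then have "sublist u (iter_image k v)" by (rule sublist_order.order.trans[OF k sublist_iter_image])
    then show "u \<in> factors w" by (rule sublist_factors[OF v(2)])
  }
qed

subsection \<open>Cyclic relabelling\<close>

text \<open>The letter map behind \<open>sigma\<close>: on ternary words applying
  \<open>sigma\<close> is composition with \<open>rot\<close>.\<close>

definition rot :: "nat \<Rightarrow> nat" where
  "rot x = (if x = 0 then 1 else if x = 1 then 2 else 0)"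

lemma morph_inf_sigma:
  assumes "range x \<subseteq> {0, 1, 2}"
  shows "morph_inf sigma x = rot \<circ> x"
proof
  fix n
  have *: "morph sigma u = map rot u" if "set u \<subseteq> {0, 1, 2}" for u
    using that by (induction u) (auto simp: sigma_def rot_def)
  have "morph sigma (map x [0..<Suc n]) = map rot (map x [0..<Suc n])"
    by (intro * subset_trans[OF _ assms]) auto
  then show "morph_inf sigma x n = (rot \<circ> x) n"
    using morph_inf_nth[of n sigma x "Suc n"] by (simp add: nth_append del: upt_Suc)
qed

lemma factors_comp: "factors (g \<circ> x) = map g ` factors x"
proof (intro equalityI subsetI)
  fix u assume "u \<in> factors (g \<circ> x)"
  then obtain i where "map (g \<circ> x) [i..<i + length u] = u"
    by (auto simp: factors_def occurs_at_def)
  then have "u = map g (map x [i..<i + length u])" by simp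
  then show "u \<in> map g ` factors x" using map_upt_in_factors by blast
next
  fix u assume "u \<in> map g ` factors x"
  then obtain i v where "map x [i..<i + length v] = v" "u = map g v"
    by (auto simp: factors_def occurs_at_def)
  then have "map (g \<circ> x) [i..<i + length v] = u" by (metis map_map)
  then show "u \<in> factors (g \<circ> x)" using map_upt_in_factors by metis
qed

lemma ternary_square_free_rot:
  assumes "ternary_square_free x"
  shows "ternary_square_free (rot \<circ> x)"
  unfolding ternary_square_free_def
proof (intro conjI ballI)
  show "range (rot \<circ> x) \<subseteq> {0, 1, 2}" by (auto simp: rot_def)
  show "recurrent (rot \<circ> x)"
    unfolding recurrent_def
  proof
    fix u assume "u \<in> factors (rot \<circ> x)"
    then obtain v where v: "v \<in> factors x" "u = map rot v" by (auto simp: factors_comp)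
    then have "infinite {i. occurs_at v x i}"
      using assms by (auto simp: ternary_square_free_def recurrent_def)
    moreover have "{i. occurs_at v x i} \<subseteq> {i. occurs_at u (rot \<circ> x) i}"
      unfolding occurs_at_def v(2) length_map by (metis (mono_tags, lifting) Collect_mono map_map)
    ultimately show "infinite {i. occurs_at u (rot \<circ> x) i}" using finite_subset by blast
  qed
  fix u assume "u \<in> factors (rot \<circ> x)"
  then obtain v where v: "v \<in> factors x" "u = map rot v" by (auto simp: factors_comp)
  have "inj_on rot {0, 1, 2}" by (auto simp: inj_on_def rot_def)
  moreover have "set v \<subseteq> {0, 1, 2}"
    using set_factor[OF v(1)] assms unfolding ternary_square_free_def by (meson subset_trans)
  ultimately have "inj_on rot (set v)" by (rule inj_on_subset)
  then show "square_free u"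
    using v assms by (auto simp: ternary_square_free_def intro: square_free_map)
qed

lemma range_eq_of_factors_eq: "factors x = factors y \<Longrightarrow> range x \<subseteq> range y"
  using set_factor[of "[x i]" y for i] map_upt_in_factors[of x i "Suc i" for i] by fastforce

lemma triple_rot:
  assumes "range x \<subseteq> {0, 1, 2}" "[rot a, rot b, rot c] \<in> factors (rot \<circ> x)" "{a, b, c} \<subseteq> {0, 1, 2}"
  shows "[a, b, c] \<in> factors x"
proof -
  obtain v where v: "v \<in> factors x" "map rot v = map rot [a, b, c]"
    using assms(2) by (auto simp: factors_comp)
  have "inj_on rot {0, 1, 2}" by (auto simp: inj_on_def rot_def)
  moreover have "set v \<union> set [a, b, c] \<subseteq> {0, 1, 2}"
    using subset_trans[OF set_factor[OF v(1)] assms(1)] assms(3) by simp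
  ultimately have "v = [a, b, c]" using v(2) by (metis inj_on_subset map_inj_on)
  then show ?thesis using v(1) by simp
qed

theorem theorem9:
  fixes f :: "'v list set" and w :: "nat \<Rightarrow> nat"
  assumes "is_formula f"
    and "card (vars f) = 3"
    and "{[A, B, A], [B, C, B], [A, C, A]} \<preceq> f"
    and "f \<preceq> {[A, B, A], [A, B, C, B, A], [A, C, A], [A, C, B], [B, C, A]}"
    and "range w \<subseteq> {0, 1, 2}"
    and "recurrent w"
    and "avoids w f"
  shows "equivalent w w3
    \<or> equivalent w (morph_inf sigma w3)
    \<or> equivalent w (morph_inf sigma (morph_inf sigma w3))"
proof -
  have upper_formula: "avoids w upper_formula" using assms(4,7) by (rule avoids_mono)
  have w: "ternary_square_free w"
    using assms(5,6) avoids_upper_formula_square_free[OF assms(6) upper_formula] by (simp add: ternary_square_free_def)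
  let ?w1 = "rot \<circ> w" and ?w2 = "rot \<circ> (rot \<circ> w)"
  have w1: "ternary_square_free ?w1" using w by (rule ternary_square_free_rot)
  have w2: "ternary_square_free ?w2" using w1 by (rule ternary_square_free_rot)
  have range1: "range ?w1 \<subseteq> {0, 1, 2}" using w1 by (simp add: ternary_square_free_def)
  \<comment> \<open>That \<open>w3\<close> is ternary is inferred from its sharing all factors with
    a ternary word.\<close>
  have range_w3: "range w3 \<subseteq> {0, 1, 2}" if "factors x = factors w3" "ternary_square_free x" for x
    using range_eq_of_factors_eq[OF that(1)[symmetric]] that(2)
    unfolding ternary_square_free_def by (meson subset_trans)
  have sigma1: "morph_inf sigma w3 = rot \<circ> w3"
    and sigma2: "morph_inf sigma (morph_inf sigma w3) = rot \<circ> (rot \<circ> w3)"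
    if "factors x = factors w3" "ternary_square_free x" for x
    using morph_inf_sigma[OF range_w3[OF that]] morph_inf_sigma[of "rot \<circ> w3"] 
    by (auto simp: rot_def)
  have rot3: "rot \<circ> (rot \<circ> (rot \<circ> w)) = w"
  proof
    fix n
    have "w n \<in> {0, 1, 2}" using assms(5) by blast
    then show "(rot \<circ> (rot \<circ> (rot \<circ> w))) n = w n" by (auto simp: rot_def)
  qed
  from missing_pair[OF w upper_formula] show ?thesis
  proof (elim disjE conjE)
    assume "[1, 2, 1] \<notin> factors w" "[2, 1, 2] \<notin> factors w"
    then show ?thesis using thue_121_212[OF w] by (simp add: equivalent_def)
  next
    \<comment> \<open>Rotation carries the pair \<open>2\<close>, \<open>0\<close> to
      \<open>0\<close>, \<open>1\<close> and then to \<open>1\<close>, \<open>2\<close>, so the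
      characterization applies to the word rotated twice. A third rotation restores
      \<open>w\<close>.\<close>
    assume n: "[2, 0, 2] \<notin> factors w" "[0, 2, 0] \<notin> factors w"
    have "[1, 2, 1] \<notin> factors ?w2" "[2, 1, 2] \<notin> factors ?w2"
      using n triple_rot[OF assms(5), of 2 0 2] triple_rot[OF assms(5), of 0 2 0]
        triple_rot[OF range1, of 0 1 0] triple_rot[OF range1, of 1 0 1]
      by (auto simp: rot_def)
    then have eq: "factors ?w2 = factors w3" by (rule thue_121_212[OF w2])
    have "factors w = map rot ` factors ?w2"
      by (metis factors_comp rot3)
    also have "\<dots> = factors (rot \<circ> w3)" unfolding eq by (rule factors_comp[symmetric])
    finally show ?thesis using sigma1[OF eq w2] by (simp add: equivalent_def)
  next
    assume n: "[0, 1, 0] \<notin> factors w" "[1, 0, 1] \<notin> factors w"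
    have "[1, 2, 1] \<notin> factors ?w1" "[2, 1, 2] \<notin> factors ?w1"
      using n triple_rot[OF assms(5), of 0 1 0] triple_rot[OF assms(5), of 1 0 1]
      by (auto simp: rot_def)
    then have eq: "factors ?w1 = factors w3" by (rule thue_121_212[OF w1])
    have "factors w = map rot ` map rot ` factors ?w1"
      by (metis factors_comp rot3)
    also have "\<dots> = factors (rot \<circ> (rot \<circ> w3))" unfolding eq by (simp only: factors_comp)
    finally show ?thesis using sigma2[OF eq w1] by (simp add: equivalent_def)
  qed
qed

end
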